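(* Let $\langle\mathcal S,\mathcal A,\mathcal P,\mathcal R,\gamma\rangle$ be a discounted Markov decision process with $\gamma\in(0,1)$, let $\alpha>0$, and let $\pi$ be a stationary policy. Assume: (a) for each $s\in\mathcal S$, if $a\sim\pi(\cdot\mid s)$, then $\log\pi(a\mid s)$ is well defined almost surely; (b) $\sup_{(s,a)\in\mathcal S\times\mathcal A}\mathbb E_{r\sim R(s,a),\,(s',a')\sim\mathcal P^\pi(\cdot\mid s,a)}\bigl[|r-\gamma\alpha\log\pi(a'\mid s')|\bigr]<\infty$; (c) for every $F\in\mathcal X^{\mathrm{cdf}}$ and $x\in\mathbb R$, the map $(s,a)\mapsto\mathbb E_{r\sim R(s,a),\,(s',a')\sim\mathcal P^\pi(\cdot\mid s,a)}\bigl[F(s',a')\bigl(\tfrac{x-r}{\gamma}+\alpha\log\pi(a'\mid s')\bigr)\bigr]$ is measurable. Then there exists a unique $F^\star\in\mathcal X^{\mathrm{cdf}}$ such that $\mathcal T^\pi_{\mathrm{cdf}}F^\star=F^\star$.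
   Context: MDP: $\mathcal S,\mathcal A$ are measurable spaces (states, actions), $\mathcal P(\cdot\mid s,a)$ is a transition kernel on $\mathcal S$, $\mathcal R:\mathcal S\times\mathcal A\times\mathcal S\to\mathbb R$ is a (measurable) reward function. A stationary policy $\pi$ assigns to each $s$ a probability distribution $\pi(\cdot\mid s)$ on $\mathcal A$; $\pi(a\mid s)$ denotes the value of its probability mass function / density. Sampling: $(s',a')\sim\mathcal P^\pi(\cdot\mid s,a)$ means $s'\sim\mathcal P(\cdot\mid s,a)$ and then $a'\sim\pi(\cdot\mid s')$; $r\sim R(s,a)$ denotes the one-step reward $r=\mathcal R(s,a,s')$ generated by the same next state $s'$. Cramér distance between laws on $\mathbb R$: $d_C(P_1,P_2)=\bigl(\int_{\mathbb R}(F_{P_1}(x)-F_{P_2}(x))^2dx\bigr)^{1/2}$, where $F_P$ is the CDF of $P$. $\delta_0$ is the Dirac law at $0$. $\Gamma_F$ is the set of CDFs $F_P$ of laws $P$ on $\mathbb R$ with $d_C(P,\delta_0)<\infty$. $\mathcal X^{\mathrm{cdf}}$ is the set of all CDF fields $F:(s,a)\mapsto F(s,a)\in\Gamma_F$ (with $(s,a)\mapsto F(s,a)(x)$ measurable for each $x\in\mathbb R$) such that $\sup_{(s,a)}\int_{\mathbb R}(F(s,a)(x)-\mathbf 1\{x\ge0\})^2dx<\infty$. Operator: for $F\in\mathcal X^{\mathrm{cdf}}$, $(\mathcal T^\pi_{\mathrm{cdf}}F)(s,a)(x):=\mathbb E_{r\sim R(s,a),\,(s',a')\sim\mathcal P^\pi(\cdot\mid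 s,a)}\bigl[F(s',a')\bigl(\tfrac{x-r}{\gamma}+\alpha\log\pi(a'\mid s')\bigr)\bigr]$. *)

theory Defs
  imports "HOL-Probability.Probability"
begin

text \<open>Measurable spaces of states and actions are represented by measures \<open>S\<close>, \<open>A\<close>, of which only
  the carrier and the sigma-algebra are used.\<close>

definition discounted_mdp ::
  "'s measure \<Rightarrow> 'a measure \<Rightarrow> ('s \<times> 'a \<Rightarrow> 's measure) \<Rightarrow> ('s \<Rightarrow> 'a \<Rightarrow> 's \<Rightarrow> real) \<Rightarrow> real \<Rightarrow> bool" where
  "discounted_mdp S A P R \<gamma> \<longleftrightarrow>
     P \<in> (S \<Otimes>\<^sub>M A) \<rightarrow>\<^sub>M prob_algebra S \<and>
     (\<lambda>(s, a, s'). R s a s') \<in> borel_measurable (S \<Otimes>\<^sub>M A \<Otimes>\<^sub>M S) \<and>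
     0 < \<gamma> \<and> \<gamma> < 1"

text \<open>A policy is a probability kernel: measurability in the state is what makes sampling
  \<open>s' \<sim> P(\<cdot>|s,a)\<close> followed by \<open>a' \<sim> \<pi>(\<cdot>|s')\<close> define a joint law.\<close>

definition stationary_policy :: "'s measure \<Rightarrow> 'a measure \<Rightarrow> ('s \<Rightarrow> 'a measure) \<Rightarrow> bool" where
  "stationary_policy S A \<pi> \<longleftrightarrow> \<pi> \<in> S \<rightarrow>\<^sub>M prob_algebra A"

text \<open>\<open>p s a\<close> is the value \<open>\<pi>(a|s)\<close> of the density of \<open>\<pi> s\<close> with respect to a reference measure
  \<open>\<nu>\<close> on the actions. Probability mass functions are the case where \<open>\<nu>\<close> is a counting measure, so
  \<open>\<nu>\<close> is not required to be sigma-finite. Joint measurability makes \<open>\<pi>(a'|s')\<close> a random variable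
  under the joint law of \<open>(s', a')\<close>.\<close>

definition policy_density ::
  "'s measure \<Rightarrow> 'a measure \<Rightarrow> ('s \<Rightarrow> 'a measure) \<Rightarrow> 'a measure \<Rightarrow> ('s \<Rightarrow> 'a \<Rightarrow> real) \<Rightarrow> bool" where
  "policy_density S A \<pi> \<nu> p \<longleftrightarrow>
     sets \<nu> = sets A \<and>
     (\<lambda>(s, a). p s a) \<in> borel_measurable (S \<Otimes>\<^sub>M A) \<and>
     (\<forall>s\<in>space S. \<forall>a\<in>space A. 0 \<le> p s a) \<and>
     (\<forall>s\<in>space S. \<pi> s = density \<nu> (\<lambda>a. ennreal (p s a)))"

definition next_state_action ::
  "'s measure \<Rightarrow> 'a measure \<Rightarrow> ('s \<times> 'a \<Rightarrow> 's measure) \<Rightarrow> ('s \<Rightarrow> 'a measure) \<Rightarrow> 's \<times> 'a \<Rightarrow> ('s \<times> 'a) measure" where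
  "next_state_action S A P \<pi> sa =
     P sa \<bind> (\<lambda>s'. \<pi> s' \<bind> (\<lambda>a'. return (S \<Otimes>\<^sub>M A) (s', a')))"

text \<open>The distance is the square root of an extended nonnegative integral and may be infinite.\<close>

definition cramer_dist :: "real measure \<Rightarrow> real measure \<Rightarrow> ennreal" where
  "cramer_dist P Q =
     (let I = (\<integral>\<^sup>+x. ennreal ((cdf P x - cdf Q x)\<^sup>2) \<partial>lborel)
      in if I = \<infinity> then \<infinity> else ennreal (sqrt (enn2real I)))"

definition Gamma_cdf :: "(real \<Rightarrow> real) set" where
  "Gamma_cdf = {cdf P | P. real_distribution P \<and> cramer_dist P (return borel 0) < \<infinity>}"

text \<open>Fields live on the carrier of \<open>S \<Otimes>\<^sub>M A\<close>; extensionality (\<open>\<rightarrow>\<^sub>E\<close> here, \<open>restrict\<close> in the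
  operator below) fixes their values elsewhere, so that HOL equality is equality of fields.\<close>

definition cdf_fields :: "'s measure \<Rightarrow> 'a measure \<Rightarrow> ('s \<times> 'a \<Rightarrow> real \<Rightarrow> real) set" where
  "cdf_fields S A = {F \<in> space (S \<Otimes>\<^sub>M A) \<rightarrow>\<^sub>E Gamma_cdf.
     (\<forall>x. (\<lambda>sa. F sa x) \<in> borel_measurable (S \<Otimes>\<^sub>M A)) \<and>
     (SUP sa\<in>space (S \<Otimes>\<^sub>M A).
        \<integral>\<^sup>+x. ennreal ((F sa x - indicator {0..} x)\<^sup>2) \<partial>lborel) < \<infinity>}"

text \<open>The reward is the function \<open>R s a s'\<close> of the sampled next state, so the expectation over
  \<open>(r, s', a')\<close> is an integral over \<open>(s', a')\<close>.\<close>

definition bellman_cdf ::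
  "'s measure \<Rightarrow> 'a measure \<Rightarrow> ('s \<times> 'a \<Rightarrow> 's measure) \<Rightarrow> ('s \<Rightarrow> 'a \<Rightarrow> 's \<Rightarrow> real) \<Rightarrow> real \<Rightarrow> real \<Rightarrow>
   ('s \<Rightarrow> 'a measure) \<Rightarrow> ('s \<Rightarrow> 'a \<Rightarrow> real) \<Rightarrow>
   ('s \<times> 'a \<Rightarrow> real \<Rightarrow> real) \<Rightarrow> 's \<times> 'a \<Rightarrow> real \<Rightarrow> real" where
  "bellman_cdf S A P R \<gamma> \<alpha> \<pi> p F =
     (\<lambda>(s, a)\<in>space (S \<Otimes>\<^sub>M A). \<lambda>x.
        \<integral>(s', a'). F (s', a') ((x - R s a s') / \<gamma> + \<alpha> * ln (p s' a'))
          \<partial>next_state_action S A P \<pi> (s, a))"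

end

theory Submission
  imports Defs "HOL-Real_Asymp.Real_Asymp"
begin

text \<open>Writing \<open>c = r - \<gamma> \<alpha> log \<pi>(a'|s')\<close>, the operator averages \<open>F(s', a')((x - c) / \<gamma>)\<close>.
  By Jensen, Tonelli and the substitution \<open>y = (x - c) / \<gamma>\<close> it contracts
  \<open>sup \<integral> \<phi>(F - G)\<close> by the factor \<open>\<gamma>\<close> for every nonnegative convex \<open>\<phi>\<close>.
  With \<open>\<phi>(t) = t\<^sup>2\<close> this gives uniqueness. For existence, \<open>\<phi> = |\<cdot>|\<close> is more convenient: the first
  moment bound on \<open>c\<close> keeps the iterates of the unit step field within a fixed \<open>L\<^sup>1\<close> distance of it,
  so successive iterates are summably close and converge almost everywhere; the right-continuous
  version of the limit is again a CDF field, and it is fixed because two right-continuous functions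
  that agree almost everywhere are equal.\<close>

section \<open>Distribution functions and membership in \<open>Gamma_cdf\<close>\<close>

definition distribution_function :: "(real \<Rightarrow> real) \<Rightarrow> bool" where
  "distribution_function f \<longleftrightarrow>
     mono f \<and> (\<forall>x. continuous (at_right x) f) \<and> (f \<longlongrightarrow> 0) at_bot \<and> (f \<longlongrightarrow> 1) at_top"

abbreviation step :: "real \<Rightarrow> real" where
  "step \<equiv> indicator {0..}"

lemma distribution_function_cdf:
  assumes "real_distribution P"
  shows "distribution_function (cdf P)"
proof -
  interpret real_distribution P by fact
  show ?thesis
    unfolding distribution_function_def mono_def
    using cdf_nondecreasing cdf_is_right_cont cdf_lim_at_bot cdf_lim_at_top_prob by auto
qed

lemma distribution_function_bounds:
  assumes "distribution_function f"
  shows "0 \<le> f x" "f x \<le> 1"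
proof -
  have m: "mono f" and b: "(f \<longlongrightarrow> 0) at_bot" and t: "(f \<longlongrightarrow> 1) at_top"
    using assms by (auto simp: distribution_function_def)
  show "0 \<le> f x"
    using m by (intro tendsto_upperbound[OF b]) (auto simp: eventually_at_bot_linorder mono_def)
  show "f x \<le> 1"
    using m by (intro tendsto_lowerbound[OF t]) (auto simp: eventually_at_top_linorder mono_def)
qed

lemma cdf_return_0: "cdf (return borel 0) = step"
  by (auto simp: cdf_def fun_eq_iff measure_return indicator_def)

lemma distribution_function_step: "distribution_function step"
proof -
  interpret prob_space "return borel (0::real)" by (rule prob_space_return) simp
  have "real_distribution (return borel (0::real))"
    by unfold_locales auto
  then show ?thesis
    using distribution_function_cdf cdf_return_0 by metis
qed

lemma cramer_dist_finite_iff: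
  "cramer_dist P Q < \<infinity> \<longleftrightarrow> (\<integral>\<^sup>+x. ennreal ((cdf P x - cdf Q x)\<^sup>2) \<partial>lborel) < \<infinity>"
  by (auto simp: cramer_dist_def Let_def top.not_eq_extremum)

text \<open>Removes the witnessing law: the Stieltjes measure \<open>interval_measure f\<close> of a
  distribution function has \<open>f\<close> as its cdf, so membership becomes a property of the
  function alone. The square root in \<open>cramer_dist\<close> does not affect finiteness.\<close>

lemma mem_Gamma_cdf_iff:
  "f \<in> Gamma_cdf \<longleftrightarrow>
     distribution_function f \<and> (\<integral>\<^sup>+x. ennreal ((f x - step x)\<^sup>2) \<partial>lborel) < \<infinity>"
proof
  assume "f \<in> Gamma_cdf"
  then show "distribution_function f \<and> (\<integral>\<^sup>+x. ennreal ((f x - step x)\<^sup>2) \<partial>lborel) < \<infinity>"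
    unfolding Gamma_cdf_def cramer_dist_finite_iff cdf_return_0
    using distribution_function_cdf by auto
next
  assume *: "distribution_function f \<and> (\<integral>\<^sup>+x. ennreal ((f x - step x)\<^sup>2) \<partial>lborel) < \<infinity>"
  then have "real_distribution (interval_measure f)" "cdf (interval_measure f) = f"
    by (auto simp: distribution_function_def mono_def
        intro!: real_distribution_interval_measure cdf_interval_measure)
  then show "f \<in> Gamma_cdf"
    using * unfolding Gamma_cdf_def cramer_dist_finite_iff cdf_return_0 by force
qed

lemma distribution_function_measurable:
  assumes "distribution_function f"
  shows "f \<in> borel_measurable borel"
  using assms by (auto simp: distribution_function_def intro: borel_measurable_mono)

section \<open>Right-continuous functions: equality from almost everywhere equality, joint
  measurability\<close>

lemma right_cont_eq_if_AE_eq: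
  fixes f g :: "real \<Rightarrow> real"
  assumes f: "\<And>x. continuous (at_right x) f" and g: "\<And>x. continuous (at_right x) g"
    and eq: "AE x in lborel. f x = g x"
  shows "f = g"
proof
  fix x
  obtain N where N: "emeasure lborel N = 0" "N \<in> sets lborel" "{x. f x \<noteq> g x} \<subseteq> N"
    using eq by (auto elim!: AE_E)
  \<comment> \<open>A null set contains no nonempty open interval, so points of agreement accumulate
    at \<open>x\<close> strictly from the right. Along such a sequence right-continuity determines
    both values at \<open>x\<close>.\<close>
  have "\<exists>y. x < y \<and> y < x + 1 / Suc n \<and> f y = g y" for n
  proof (rule ccontr)
    assume "\<not> ?thesis"
    then have "{x<..<x + 1 / Suc n} \<subseteq> N" using N(3) by auto
    then have "emeasure lborel {x<..<x + 1 / Suc n} \<le> emeasure lborel N"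
      using N(2) by (rule emeasure_mono)
    then show False using N(1) by (simp add: ennreal_eq_0_iff)
  qed
  then obtain y where y: "\<And>n. x < y n" "\<And>n. y n < x + 1 / Suc n" "\<And>n. f (y n) = g (y n)"
    by metis
  have "y \<longlonglongrightarrow> x"
  proof (rule tendsto_sandwich[where f = "\<lambda>_. x"])
    show "(\<lambda>n. x + 1 / Suc n) \<longlonglongrightarrow> x"
      using tendsto_add[OF tendsto_const LIMSEQ_inverse_real_of_nat, of x]
      by (simp add: inverse_eq_divide)
  qed (use y in \<open>auto intro!: always_eventually less_imp_le simp del: of_nat_Suc\<close>)
  then have lim: "filterlim y (at_right x) sequentially"
    using y(1) by (auto simp: filterlim_at intro!: always_eventually less_imp_neq[THEN not_sym])
  have "(\<lambda>n. f (y n)) \<longlonglongrightarrow> f x" "(\<lambda>n. g (y n)) \<longlonglongrightarrow> g x"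
    using f g lim by (auto simp: continuous_within intro: filterlim_compose)
  then show "f x = g x" using y(3) LIMSEQ_unique by auto
qed

text \<open>Rounding \<open>x\<close> up to a grid of mesh \<open>1 / Suc n\<close> leaves only
  countably many sections \<open>F z q\<close>, each measurable by assumption; right-continuity
  recovers \<open>F z x\<close> as the mesh shrinks.\<close>

lemma measurable_right_cont_family:
  fixes F :: "'b \<Rightarrow> real \<Rightarrow> real"
  assumes [measurable]: "\<And>x. (\<lambda>z. F z x) \<in> borel_measurable M"
    and cont: "\<And>z x. z \<in> space M \<Longrightarrow> continuous (at_right x) (F z)"
  shows "(\<lambda>(z, x). F z x) \<in> borel_measurable (M \<Otimes>\<^sub>M borel)"
proof (rule borel_measurable_LIMSEQ_real)
  \<comment> \<open>Floor plus one, rather than the ceiling, puts the grid point strictly to the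
    right of \<open>x\<close> even when \<open>x\<close> is on the grid, as the filter
    \<open>at_right x\<close> demands.\<close>
  let ?q = "\<lambda>n x. (real_of_int \<lfloor>real (Suc n) * x\<rfloor> + 1) / real (Suc n)"
  show "(\<lambda>n. (\<lambda>(z, x). F z (?q n x)) zx) \<longlonglongrightarrow> (\<lambda>(z, x). F z x) zx"
    if zx: "zx \<in> space (M \<Otimes>\<^sub>M borel)" for zx
  proof -
    obtain z x where [simp]: "zx = (z, x)" and z: "z \<in> space M"
      using zx by (auto simp: space_pair_measure)
    have gt: "x < ?q n x" for n
    proof -
      have "real (Suc n) * x < real_of_int \<lfloor>real (Suc n) * x\<rfloor> + 1" by linarith
      then show ?thesis by (simp add: pos_less_divide_eq mult.commute)
    qed
    have le: "?q n x \<le> x + 1 / real (Suc n)" for n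
    proof -
      have "real_of_int \<lfloor>real (Suc n) * x\<rfloor> + 1 \<le> real (Suc n) * x + 1" by linarith
      then have "?q n x \<le> (real (Suc n) * x + 1) / real (Suc n)"
        by (intro divide_right_mono) auto
      also have "\<dots> = x + 1 / real (Suc n)" by (simp add: add_divide_distrib)
      finally show ?thesis .
    qed
    have "(\<lambda>n. ?q n x) \<longlonglongrightarrow> x"
    proof (rule tendsto_sandwich[where f = "\<lambda>_. x"])
      show "(\<lambda>n. x + 1 / real (Suc n)) \<longlonglongrightarrow> x"
        using tendsto_add[OF tendsto_const LIMSEQ_inverse_real_of_nat, of x]
        by (simp add: inverse_eq_divide)
    qed (use gt[THEN less_imp_le] le in \<open>auto intro!: always_eventually simp del: of_nat_Suc\<close>)
    then have "filterlim (\<lambda>n. ?q n x) (at_right x) sequentially"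
      using gt by (auto simp: filterlim_at simp del: of_nat_Suc
          intro!: always_eventually less_imp_neq[THEN not_sym])
    then show ?thesis
      using cont[OF z, of x] by (auto simp: continuous_within intro: filterlim_compose)
  qed
  show "(\<lambda>(z, x). F z (?q n x)) \<in> borel_measurable (M \<Otimes>\<^sub>M borel)" for n
  proof -
    have "(\<lambda>zx. (\<lambda>i zx. F (fst zx) ((real_of_int i + 1) / real (Suc n))) \<lfloor>real (Suc n) * snd zx\<rfloor> zx)
        \<in> borel_measurable (M \<Otimes>\<^sub>M borel)"
      by (rule measurable_compose_countable) measurable
    then show ?thesis by (simp add: case_prod_beta)
  qed
qed

section \<open>The right-continuous version of a monotone function\<close>

definition right_limit :: "(real \<Rightarrow> real) \<Rightarrow> real \<Rightarrow> real" where
  "right_limit g x = Inf (g ` {x<..})"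

lemma
  assumes "mono g"
  shows right_limit_le: "x < y \<Longrightarrow> right_limit g x \<le> g y"
    and right_limit_lessD: "right_limit g x < a \<Longrightarrow> \<exists>y>x. g y < a"
    and le_right_limit: "g x \<le> right_limit g x"
proof -
  \<comment> \<open>Without a lower bound \<open>Inf\<close> on the reals would be an uninformative
    default; monotonicity supplies \<open>g x\<close>.\<close>
  have bdd: "bdd_below (g ` {x<..})"
    using assms by (auto intro!: bdd_belowI[of _ "g x"] simp: mono_def)
  show "x < y \<Longrightarrow> right_limit g x \<le> g y"
    unfolding right_limit_def using bdd by (auto intro: cInf_lower)
  show "right_limit g x < a \<Longrightarrow> \<exists>y>x. g y < a"
    unfolding right_limit_def by (subst (asm) cInf_less_iff[OF _ bdd]) auto
  show "g x \<le> right_limit g x"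
    unfolding right_limit_def using assms by (intro cInf_greatest) (auto simp: mono_def)
qed

lemma tendsto_right_limit:
  assumes "mono g"
  shows "(g \<longlongrightarrow> right_limit g x) (at_right x)"
proof (rule order_tendstoI)
  fix a assume a: "a < right_limit g x"
  then show "\<forall>\<^sub>F y in at_right x. a < g y"
    using right_limit_le[OF assms] by (auto simp: eventually_at_right_field intro!: exI[of _ "x + 1"] less_le_trans[OF a])
next
  fix a assume "right_limit g x < a"
  then obtain y where y: "y > x" "g y < a" using right_limit_lessD[OF assms] by blast
  then show "\<forall>\<^sub>F y in at_right x. g y < a"
    using assms y(1) by (auto simp: eventually_at_right_field mono_def intro!: exI[of _ y] le_less_trans[OF _ y(2)])
qed

lemma mono_right_limit:
  assumes "mono g"
  shows "mono (right_limit g)"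
proof (rule monoI)
  fix x y :: real assume "x \<le> y"
  then show "right_limit g x \<le> right_limit g y"
    using right_limit_le[OF assms, of x y] le_right_limit[OF assms, of y] by (cases "x = y") auto
qed

lemma continuous_right_limit:
  assumes "mono g"
  shows "continuous (at_right x) (right_limit g)"
  unfolding continuous_within
proof (rule order_tendstoI)
  fix a assume a: "a < right_limit g x"
  then show "\<forall>\<^sub>F y in at_right x. a < right_limit g y"
    using mono_right_limit[OF assms]
    by (auto simp: eventually_at_right_field mono_def intro!: exI[of _ "x + 1"] less_le_trans[OF a])
next
  fix a assume "right_limit g x < a"
  then obtain y where y: "y > x" "g y < a" using right_limit_lessD[OF assms] by blast
  then show "\<forall>\<^sub>F y in at_right x. right_limit g y < a"
    using right_limit_le[OF assms] y(1)
    by (auto simp: eventually_at_right_field intro!: exI[of _ y] le_less_trans[OF _ y(2)])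
qed

text \<open>A monotone function has at most countably many discontinuities, and at every other point
  its right limit is its value.\<close>

lemma AE_right_limit_eq:
  assumes "mono g"
  shows "AE x in lborel. right_limit g x = g x"
proof -
  have "AE x in lborel. x \<notin> {x. \<not> isCont g x}"
    using mono_ctble_discont[OF assms] countable_imp_null_set_lborel
    by (intro AE_not_in) auto
  then show ?thesis
  proof eventually_elim
    case (elim x)
    then have "(g \<longlongrightarrow> g x) (at_right x)"
      by (auto simp: isCont_def filterlim_at_split)
    then show ?case
      using tendsto_unique[OF _ tendsto_right_limit[OF assms]] by simp
  qed
qed

text \<open>The infimum over uncountably many points is also the limit along the single sequence
  \<open>x + 1 / Suc n\<close>, hence a countable limit of measurable functions of
  \<open>z\<close>.\<close>

lemma measurable_right_limit:
  assumes [measurable]: "\<And>x. (\<lambda>z. g z x) \<in> borel_measurable M"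
    and mono: "\<And>z. z \<in> space M \<Longrightarrow> mono (g z)"
  shows "(\<lambda>z. right_limit (g z) x) \<in> borel_measurable M"
proof (rule borel_measurable_LIMSEQ_real)
  have "(\<lambda>n. x + inverse (real (Suc n))) \<longlonglongrightarrow> x"
    using tendsto_add[OF tendsto_const LIMSEQ_inverse_real_of_nat, of x] by simp
  then have "filterlim (\<lambda>n. x + inverse (real (Suc n))) (at_right x) sequentially"
    by (auto simp: filterlim_at simp del: of_nat_Suc)
  then show "(\<lambda>n. g z (x + inverse (real (Suc n)))) \<longlonglongrightarrow> right_limit (g z) x" if "z \<in> space M" for z
    using tendsto_right_limit[OF mono[OF that]] by (rule filterlim_compose[rotated])
qed measurable

section \<open>Uses of \<open>L\<^sup>1\<close> bounds: tails, triangle inequality, almost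
  everywhere convergence\<close>

lemma distribution_functionI_integrable_diff:
  assumes mono: "mono f" and cont: "\<And>x. continuous (at_right x) f"
    and bounds: "\<And>x. 0 \<le> f x" "\<And>x. f x \<le> 1"
    and fin: "(\<integral>\<^sup>+x. ennreal \<bar>f x - step x\<bar> \<partial>lborel) < \<infinity>"
  shows "distribution_function f"
proof -
  have half: "emeasure lborel {..<0::real} = \<infinity>" "emeasure lborel {0::real..} = \<infinity>"
  proof -
    have "of_nat n \<le> emeasure lborel {..<0::real}" "of_nat n \<le> emeasure lborel {0::real..}" for n
    proof -
      have "emeasure lborel {-real n..<0} \<le> emeasure lborel {..<0::real}"
           "emeasure lborel {0..real n} \<le> emeasure lborel {0::real..}"
        by (intro emeasure_mono; auto)+
      then show "of_nat n \<le> emeasure lborel {..<0::real}" "of_nat n \<le> emeasure lborel {0::real..}"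
        by (simp_all add: ennreal_of_nat_eq_real_of_nat)
    qed
    moreover have "e = \<infinity>" if "\<And>n. of_nat n \<le> e" for e :: ennreal
      using SUP_least[of UNIV of_nat e] that by (simp add: ennreal_SUP_of_nat_eq_top top_unique)
    ultimately show "emeasure lborel {..<0::real} = \<infinity>" "emeasure lborel {0::real..} = \<infinity>"
      by blast+
  qed
  \<comment> \<open>Markov's inequality: on a set of infinite measure the distance to the step
    cannot stay above \<open>e\<close>. Applied to the two half-lines, this gives one point where
    \<open>f\<close> is close to 0 and one where it is close to 1; monotonicity spreads each
    estimate over the whole tail.\<close>
  have not_ge: "\<not> (\<forall>x\<in>I. e \<le> \<bar>f x - step x\<bar>)"
    if "emeasure lborel I = \<infinity>" "I \<in> sets lborel" "0 < e" for e I
  proof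
    assume le: "\<forall>x\<in>I. e \<le> \<bar>f x - step x\<bar>"
    have "ennreal e * emeasure lborel I = (\<integral>\<^sup>+x. ennreal e * indicator I x \<partial>lborel)"
      using that by (intro nn_integral_cmult_indicator[symmetric]) auto
    also have "\<dots> \<le> (\<integral>\<^sup>+x. ennreal \<bar>f x - step x\<bar> \<partial>lborel)"
      using le by (intro nn_integral_mono) (auto simp: indicator_def intro!: ennreal_leI)
    finally show False
      using fin that by (auto simp: ennreal_mult_top top.extremum_unique)
  qed
  have "(f \<longlongrightarrow> 0) at_bot"
  proof (rule order_tendstoI)
    fix a :: real assume "0 < a"
    then obtain x where x: "x < 0" "f x < a"
      using not_ge[OF half(1), of a] bounds by (auto simp: not_le)
    then show "\<forall>\<^sub>F x in at_bot. f x < a"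
      using mono by (auto simp: eventually_at_bot_linorder mono_def intro!: exI[of _ x] le_less_trans[OF _ x(2)])
  qed (auto intro!: always_eventually less_le_trans[OF _ bounds(1)])
  moreover have "(f \<longlongrightarrow> 1) at_top"
  proof (rule order_tendstoI)
    fix a :: real assume "a < 1"
    then obtain x where "x \<ge> 0" "\<bar>f x - 1\<bar> < 1 - a"
      using not_ge[OF half(2), of "1 - a"] by (auto simp: not_le)
    then have x: "a < f x" by linarith
    then show "\<forall>\<^sub>F x in at_top. a < f x"
      using mono by (auto simp: eventually_at_top_linorder mono_def intro!: exI[of _ x] less_le_trans[OF x])
  qed (auto intro!: always_eventually le_less_trans[OF bounds(2)])
  ultimately show ?thesis
    using mono cont by (simp add: distribution_function_def)
qed

lemma nn_integral_abs_triangle: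
  fixes f g h :: "real \<Rightarrow> real"
  assumes "distribution_function f" "distribution_function g" "distribution_function h"
  shows "(\<integral>\<^sup>+x. ennreal \<bar>f x - h x\<bar> \<partial>lborel) \<le>
    (\<integral>\<^sup>+x. ennreal \<bar>f x - g x\<bar> \<partial>lborel) + (\<integral>\<^sup>+x. ennreal \<bar>g x - h x\<bar> \<partial>lborel)"
proof -
  note [measurable] = assms[THEN distribution_function_measurable]
  show ?thesis
    by (subst nn_integral_add[symmetric])
       (auto intro!: nn_integral_mono simp: ennreal_plus[symmetric] simp del: ennreal_plus)
qed

text \<open>The sum of the absolute increments has finite integral, hence is finite almost
  everywhere; there the increments are absolutely summable and telescope to the sequence.\<close>

lemma AE_convergent_if_nn_integral_diff_le:
  fixes f :: "nat \<Rightarrow> real \<Rightarrow> real"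
  assumes [measurable]: "\<And>n. f n \<in> borel_measurable M"
    and le: "\<And>n. (\<integral>\<^sup>+x. ennreal \<bar>f (Suc n) x - f n x\<bar> \<partial>M) \<le> ennreal (a n)"
    and a: "summable a" "\<And>n. 0 \<le> a n"
  shows "AE x in M. convergent (\<lambda>n. f n x)"
proof -
  have "(\<integral>\<^sup>+x. (\<Sum>n. ennreal \<bar>f (Suc n) x - f n x\<bar>) \<partial>M)
      = (\<Sum>n. \<integral>\<^sup>+x. ennreal \<bar>f (Suc n) x - f n x\<bar> \<partial>M)"
    by (rule nn_integral_suminf) measurable
  also have "\<dots> \<le> (\<Sum>n. ennreal (a n))" by (intro suminf_le le) auto
  also have "\<dots> = ennreal (suminf a)" using a by (intro suminf_ennreal2) auto
  finally have "(\<integral>\<^sup>+x. (\<Sum>n. ennreal \<bar>f (Suc n) x - f n x\<bar>) \<partial>M) \<noteq> \<infinity>"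
    using ennreal_less_top top.extremum_strict by (metis infinity_ennreal_def leD)
  then have "AE x in M. (\<Sum>n. ennreal \<bar>f (Suc n) x - f n x\<bar>) \<noteq> \<infinity>"
    by (rule nn_integral_PInf_AE[rotated]) measurable
  then show ?thesis
  proof eventually_elim
    case (elim x)
    then have "summable (\<lambda>n. \<bar>f (Suc n) x - f n x\<bar>)"
      by (intro summable_suminf_not_top) simp_all
    then have "summable (\<lambda>n. f (Suc n) x - f n x)"
      by (rule summable_rabs_cancel)
    then have "convergent (\<lambda>n. \<Sum>i<n. f (Suc i) x - f i x)"
      by (simp add: summable_iff_convergent)
    then have "convergent (\<lambda>n. f n x - f 0 x)" by (simp add: sum_lessThan_telescope[of "\<lambda>i. f i x"])
    then show ?case by (simp add: convergent_diff_const_right_iff)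
  qed
qed

section \<open>The averaging operator with affine rescaling: contraction, preserved properties,
  uniqueness\<close>

locale affine_bellman =
  fixes M :: "'b measure" and N :: "'b \<Rightarrow> 'b measure" and c :: "'b \<Rightarrow> 'b \<Rightarrow> real" and \<gamma> :: real
  assumes prob_space_N: "z \<in> space M \<Longrightarrow> prob_space (N z)"
    and sets_N: "z \<in> space M \<Longrightarrow> sets (N z) = sets M"
    and measurable_c: "z \<in> space M \<Longrightarrow> c z \<in> borel_measurable M"
    and \<gamma>_pos: "0 < \<gamma>" and \<gamma>_less_1: "\<gamma> < 1"
begin

text \<open>Points of \<open>M\<close> stand for state-action pairs, \<open>N z\<close> for the law
  of the next pair, and \<open>c z w\<close> for the reward minus the scaled log-density.
  Measurability of the result in \<open>z\<close> is a separate assumption of the locale for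
  existence, matching hypothesis (c).\<close>

definition bellman :: "('b \<Rightarrow> real \<Rightarrow> real) \<Rightarrow> 'b \<Rightarrow> real \<Rightarrow> real" where
  "bellman F = (\<lambda>z\<in>space M. \<lambda>x. \<integral>w. F w ((x - c z w) / \<gamma>) \<partial>N z)"

text \<open>Fields of distribution functions without any bound on their distance to the step; the
  uniqueness and existence arguments add their own bounds, one squared and one absolute.\<close>

definition cdf_family :: "('b \<Rightarrow> real \<Rightarrow> real) \<Rightarrow> bool" where
  "cdf_family F \<longleftrightarrow> F \<in> extensional (space M) \<and> (\<forall>x. (\<lambda>z. F z x) \<in> borel_measurable M) \<and>
     (\<forall>z\<in>space M. distribution_function (F z))"

lemma cdf_familyD:
  assumes "cdf_family F"
  shows "F \<in> extensional (space M)" "(\<lambda>z. F z x) \<in> borel_measurable M"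
    "z \<in> space M \<Longrightarrow> distribution_function (F z)"
  using assms by (auto simp: cdf_family_def)

lemma cdf_family_bounds:
  assumes "cdf_family F" "z \<in> space M"
  shows "0 \<le> F z x" "F z x \<le> 1"
  using distribution_function_bounds[OF cdf_familyD(3)[OF assms]] by auto

lemma measurable_cdf_family:
  assumes "cdf_family F"
  shows "(\<lambda>(z, x). F z x) \<in> borel_measurable (M \<Otimes>\<^sub>M borel)"
  using assms by (intro measurable_right_cont_family) (auto simp: cdf_family_def distribution_function_def)

text \<open>Tonelli needs the integrand jointly measurable in \<open>(w, x)\<close>. This is
  inherited from the family through the affine substitution.\<close>

lemma measurable_bellman_integrand:
  assumes F: "cdf_family F" and z: "z \<in> space M"
  shows "(\<lambda>(w, x). F w ((x - c z w) / \<gamma>)) \<in> borel_measurable (N z \<Otimes>\<^sub>M borel)"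
proof -
  note [measurable_cong] = sets_N[OF z]
  note [measurable] = measurable_c[OF z]
  have "(\<lambda>(w, x). (w, (x - c z w) / \<gamma>)) \<in> N z \<Otimes>\<^sub>M borel \<rightarrow>\<^sub>M M \<Otimes>\<^sub>M borel" by measurable
  from measurable_compose[OF this measurable_cdf_family[OF F]]
  show ?thesis by (simp add: case_prod_beta)
qed

lemma measurable_bellman_integrand_at:
  assumes "cdf_family F" and "z \<in> space M"
  shows "(\<lambda>w. F w ((x - c z w) / \<gamma>)) \<in> borel_measurable (N z)"
  using measurable_compose[OF measurable_Pair2' measurable_bellman_integrand[OF assms], of x]
  by simp

lemma space_N: "z \<in> space M \<Longrightarrow> space (N z) = space M"
  by (rule sets_eq_imp_space_eq) (rule sets_N)

lemma integrable_bellman: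
  assumes F: "cdf_family F" and z: "z \<in> space M"
  shows "integrable (N z) (\<lambda>w. F w ((x - c z w) / \<gamma>))"
proof -
  interpret prob_space "N z" by (rule prob_space_N[OF z])
  show ?thesis
    using cdf_family_bounds[OF F] space_N[OF z]
    by (intro integrable_const_bound[where B = 1] measurable_bellman_integrand_at[OF F z]) auto
qed

lemma nn_integral_rescale:
  fixes f :: "real \<Rightarrow> ennreal"
  assumes [measurable]: "f \<in> borel_measurable borel"
  shows "(\<integral>\<^sup>+x. f ((x - t) / \<gamma>) \<partial>lborel) = ennreal \<gamma> * (\<integral>\<^sup>+x. f x \<partial>lborel)"
  using \<gamma>_pos
  by (subst nn_integral_real_affine[where c = \<gamma> and t = t]) (auto simp: ac_simps)

text \<open>A general \<open>\<phi>\<close> serves both the square and the absolute value. Its bound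
  on \<open>[-1, 1]\<close>, where differences of distribution functions live, gives the
  integrability that Jensen asks for; the factor \<open>\<gamma>\<close> is the Jacobian in
  \<open>nn_integral_rescale\<close>, whatever the shift \<open>c z w\<close> is.\<close>

lemma bellman_contraction:
  fixes \<phi> :: "real \<Rightarrow> real"
  assumes F: "cdf_family F" and G: "cdf_family G" and z: "z \<in> space M"
    and \<phi>: "convex_on UNIV \<phi>" "\<And>t. 0 \<le> \<phi> t" "\<And>t. \<bar>t\<bar> \<le> 1 \<Longrightarrow> \<phi> t \<le> 1"
    and [measurable]: "\<phi> \<in> borel_measurable borel"
    and le: "\<And>w. w \<in> space M \<Longrightarrow> (\<integral>\<^sup>+x. ennreal (\<phi> (F w x - G w x)) \<partial>lborel) \<le> C"
  shows "(\<integral>\<^sup>+x. ennreal (\<phi> (bellman F z x - bellman G z x)) \<partial>lborel) \<le> ennreal \<gamma> * C"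
proof -
  interpret prob_space "N z" by (rule prob_space_N[OF z])
  interpret pair_sigma_finite "N z" lborel ..
  define D where "D w x = F w ((x - c z w) / \<gamma>) - G w ((x - c z w) / \<gamma>)" for w x
  note [measurable] = measurable_bellman_integrand[OF F z] measurable_bellman_integrand[OF G z]
  have [measurable]: "(\<lambda>(w, x). D w x) \<in> borel_measurable (N z \<Otimes>\<^sub>M borel)"
    unfolding D_def by measurable
  have [measurable]: "(\<lambda>w. D w x) \<in> borel_measurable (N z)" for x
    unfolding D_def
    using measurable_bellman_integrand_at[OF F z] measurable_bellman_integrand_at[OF G z] by simp
  have D_bound: "\<bar>D w x\<bar> \<le> 1" if "w \<in> space M" for w x
    using cdf_family_bounds[OF F that, of "(x - c z w) / \<gamma>"] cdf_family_bounds[OF G that, of "(x - c z w) / \<gamma>"]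
    unfolding D_def by linarith
  have jensen: "ennreal (\<phi> (bellman F z x - bellman G z x)) \<le> (\<integral>\<^sup>+w. ennreal (\<phi> (D w x)) \<partial>N z)" for x
  proof -
    have int: "integrable (N z) (\<lambda>w. \<phi> (D w x))"
      using \<phi> D_bound space_N[OF z] by (intro integrable_const_bound[where B = 1]) auto
    have "bellman F z x - bellman G z x = expectation (\<lambda>w. D w x)"
      using z integrable_bellman[OF F z] integrable_bellman[OF G z] by (simp add: bellman_def D_def)
    also have "\<phi> \<dots> \<le> expectation (\<lambda>w. \<phi> (D w x))"
      using integrable_bellman[OF F z] integrable_bellman[OF G z] int \<phi>(1)
      by (intro jensens_inequality[where I = UNIV]) (auto simp: D_def)
    finally show ?thesis
      using int \<phi>(2) by (simp add: nn_integral_eq_integral ennreal_leI)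
  qed
  have "(\<integral>\<^sup>+x. ennreal (\<phi> (bellman F z x - bellman G z x)) \<partial>lborel) \<le>
      (\<integral>\<^sup>+x. \<integral>\<^sup>+w. ennreal (\<phi> (D w x)) \<partial>N z \<partial>lborel)"
    by (intro nn_integral_mono jensen)
  also have "\<dots> = (\<integral>\<^sup>+w. \<integral>\<^sup>+x. ennreal (\<phi> (D w x)) \<partial>lborel \<partial>N z)"
    by (rule Fubini') measurable
  also have "\<dots> \<le> (\<integral>\<^sup>+w. ennreal \<gamma> * C \<partial>N z)"
  proof (rule nn_integral_mono)
    fix w assume "w \<in> space (N z)"
    then have w: "w \<in> space M" using space_N[OF z] by simp
    have [measurable]: "F w \<in> borel_measurable borel" "G w \<in> borel_measurable borel"
      using cdf_familyD(3)[OF F w] cdf_familyD(3)[OF G w] distribution_function_measurable by auto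
    show "(\<integral>\<^sup>+x. ennreal (\<phi> (D w x)) \<partial>lborel) \<le> ennreal \<gamma> * C"
      unfolding D_def
      by (subst nn_integral_rescale[of "\<lambda>y. ennreal (\<phi> (F w y - G w y))"])
         (auto intro!: mult_left_mono le w)
  qed
  also have "\<dots> = ennreal \<gamma> * C" by (simp add: emeasure_space_1)
  finally show ?thesis .
qed

text \<open>Monotonicity passes through the average pointwise in \<open>w\<close>; right-continuity
  and both tail limits pass through it by dominated convergence, with the constant 1 as dominating
  function.\<close>

lemma distribution_function_bellman:
  assumes F: "cdf_family F" and z: "z \<in> space M"
  shows "distribution_function (bellman F z)"
proof -
  interpret prob_space "N z" by (rule prob_space_N[OF z])
  have dist: "distribution_function (F w)" if "w \<in> space (N z)" for w
    using cdf_familyD(3)[OF F] that space_N[OF z] by auto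
  have bnd: "norm (F w x) \<le> 1" if "w \<in> space (N z)" for w x
    using distribution_function_bounds[OF dist[OF that]] by auto
  \<comment> \<open>Dominated convergence along \<open>at_top\<close> covers all three limits once
    each filter is written as an image of \<open>at_top\<close> under some \<open>h\<close>: an
    inverse for \<open>at_right\<close>, negation for \<open>at_bot\<close>, the identity for
    \<open>at_top\<close>.\<close>
  have dct: "(bellman F z \<longlongrightarrow> expectation f) filt"
    if filt: "filt = filtermap h at_top"
      and lim: "\<And>w. w \<in> space (N z) \<Longrightarrow> ((\<lambda>x. F w ((x - c z w) / \<gamma>)) \<longlongrightarrow> f w) filt"
      and f: "f \<in> borel_measurable (N z)" for filt f and h :: "real \<Rightarrow> real"
    unfolding bellman_def restrict_apply'[OF z] filt filterlim_filtermap
    using lim bnd f measurable_bellman_integrand_at[OF F z] unfolding filt filterlim_filtermap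
    by (intro integral_dominated_convergence_at_top[where w = "\<lambda>_. 1"]) auto
  have affine: "filterlim (\<lambda>x. (x - t) / \<gamma>) at_bot at_bot" "filterlim (\<lambda>x. (x - t) / \<gamma>) at_top at_top"
    "filterlim (\<lambda>x. (x - t) / \<gamma>) (at_right ((a - t) / \<gamma>)) (at_right a)" for a t
  proof -
    show "filterlim (\<lambda>x. (x - t) / \<gamma>) at_bot at_bot" 
      using \<gamma>_pos by real_asymp
    show "filterlim (\<lambda>x. (x - t) / \<gamma>) at_top at_top"
      using \<gamma>_pos by real_asymp
    \<comment> \<open>Convergence alone would allow approach from either side;
      \<open>\<gamma> > 0\<close> makes the map strictly increasing, which keeps the image strictly
      on the right.\<close>
    have "((\<lambda>x. (x - t) / \<gamma>) \<longlongrightarrow> (a - t) / \<gamma>) (at_right a)"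
      by (intro tendsto_intros) (use \<gamma>_pos in auto)
    then show "filterlim (\<lambda>x. (x - t) / \<gamma>) (at_right ((a - t) / \<gamma>)) (at_right a)"
      using \<gamma>_pos
      by (auto simp: filterlim_at eventually_at_right_field divide_strict_right_mono intro!: exI[of _ "a + 1"])
  qed
  show ?thesis
    unfolding distribution_function_def
  proof (intro conjI allI)
    show "mono (bellman F z)"
    proof (rule monoI)
      fix x y :: real assume "x \<le> y"
      then have "(x - c z w) / \<gamma> \<le> (y - c z w) / \<gamma>" for w
        using \<gamma>_pos by (simp add: divide_right_mono)
      then show "bellman F z x \<le> bellman F z y"
        using dist z unfolding bellman_def
        by (auto intro!: integral_mono integrable_bellman[OF F z] simp: distribution_function_def mono_def)
    qed
    show "continuous (at_right a) (bellman F z)" for a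
    proof -
      have "(bellman F z \<longlongrightarrow> expectation (\<lambda>w. F w ((a - c z w) / \<gamma>))) (at_right a)"
      proof (rule dct)
        show "at_right a = filtermap (\<lambda>x. inverse x + a) at_top"
          by (subst at_right_to_0) (simp add: at_right_to_top filtermap_filtermap)
        show "((\<lambda>x. F w ((x - c z w) / \<gamma>)) \<longlongrightarrow> F w ((a - c z w) / \<gamma>)) (at_right a)"
          if "w \<in> space (N z)" for w
          using dist[OF that] affine(3)
          by (auto simp: distribution_function_def continuous_within intro: filterlim_compose)
      qed (rule measurable_bellman_integrand_at[OF F z])
      then show ?thesis using z by (simp add: continuous_within bellman_def)
    qed
    show "(bellman F z \<longlongrightarrow> 0) at_bot"
    proof -
      have "(bellman F z \<longlongrightarrow> expectation (\<lambda>_. 0)) at_bot"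
      proof (rule dct)
        show "((\<lambda>x. F w ((x - c z w) / \<gamma>)) \<longlongrightarrow> 0) at_bot" if "w \<in> space (N z)" for w
          using dist[OF that] affine(1) by (auto simp: distribution_function_def intro: filterlim_compose)
      qed (auto simp: at_bot_mirror)
      then show ?thesis by simp
    qed
    show "(bellman F z \<longlongrightarrow> 1) at_top"
    proof -
      have "(bellman F z \<longlongrightarrow> expectation (\<lambda>_. 1)) at_top"
      proof (rule dct)
        show "((\<lambda>x. F w ((x - c z w) / \<gamma>)) \<longlongrightarrow> 1) at_top" if "w \<in> space (N z)" for w
          using dist[OF that] affine(2) by (auto simp: distribution_function_def intro: filterlim_compose)
        show "at_top = filtermap (\<lambda>x. x) (at_top :: real filter)" by (simp add: filtermap_ident)
      qed simp
      then show ?thesis by (simp add: prob_space)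
    qed
  qed
qed

text \<open>Carries the absolute bounds of the existence argument over to the squared bounds that
  define \<open>cdf_fields\<close>.\<close>

lemma cdf_family_square_le_abs:
  assumes F: "cdf_family F" and z: "z \<in> space M"
  shows "(\<integral>\<^sup>+x. ennreal ((F z x - step x)\<^sup>2) \<partial>lborel) \<le> (\<integral>\<^sup>+x. ennreal \<bar>F z x - step x\<bar> \<partial>lborel)"
proof (intro nn_integral_mono ennreal_leI)
  fix x :: real
  have "\<bar>F z x - step x\<bar> \<le> 1"
    using cdf_family_bounds[OF F z, of x] by (auto simp: indicator_def)
  then have "\<bar>F z x - step x\<bar> * \<bar>F z x - step x\<bar> \<le> \<bar>F z x - step x\<bar>"
    by (intro mult_left_le) auto
  then show "(F z x - step x)\<^sup>2 \<le> \<bar>F z x - step x\<bar>"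
    by (simp add: power2_eq_square)
qed

text \<open>Applying the operator \<open>n\<close> times changes neither field, yet shrinks their
  squared distance by \<open>\<gamma> ^ n\<close>. Since that distance is finite uniformly in
  \<open>z\<close> at the start, it is zero.\<close>

lemma bellman_fixed_point_unique:
  assumes F: "cdf_family F" "bellman F = F" and G: "cdf_family G" "bellman G = G"
    and bF: "\<And>z. z \<in> space M \<Longrightarrow> (\<integral>\<^sup>+x. ennreal ((F z x - step x)\<^sup>2) \<partial>lborel) \<le> ennreal C"
    and bG: "\<And>z. z \<in> space M \<Longrightarrow> (\<integral>\<^sup>+x. ennreal ((G z x - step x)\<^sup>2) \<partial>lborel) \<le> ennreal C"
    and C: "0 \<le> C"
  shows "F = G"
proof (rule extensionalityI[of _ "space M"])
  note dist = cdf_familyD(3)[OF F(1)] cdf_familyD(3)[OF G(1)]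
  show "F z = G z" if z: "z \<in> space M" for z
  proof (rule right_cont_eq_if_AE_eq)
    have base: "(\<integral>\<^sup>+x. ennreal ((F z x - G z x)\<^sup>2) \<partial>lborel) \<le> ennreal (4 * C)" if z: "z \<in> space M" for z
    proof -
      note [measurable] = dist[OF z, THEN distribution_function_measurable]
      \<comment> \<open>This is \<open>(a - b)\<^sup>2 \<le> 2 * a\<^sup>2 + 2 * b\<^sup>2\<close>,
        a rearrangement of \<open>0 \<le> (a + b)\<^sup>2\<close>; hence the constant
        \<open>4 * C\<close>.\<close>
      have "(F z x - G z x)\<^sup>2 \<le> 2 * (F z x - step x)\<^sup>2 + 2 * (G z x - step x)\<^sup>2" for x
        using zero_le_power2[of "(F z x - step x) + (G z x - step x)"]
        by (simp add: power2_eq_square algebra_simps)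
      then have "(\<integral>\<^sup>+x. ennreal ((F z x - G z x)\<^sup>2) \<partial>lborel) \<le>
          (\<integral>\<^sup>+x. 2 * ennreal ((F z x - step x)\<^sup>2) + 2 * ennreal ((G z x - step x)\<^sup>2) \<partial>lborel)"
        by (intro nn_integral_mono)
           (auto simp: ennreal_mult'[symmetric] ennreal_plus[symmetric] ennreal_numeral[symmetric]
             simp del: ennreal_plus ennreal_numeral intro!: ennreal_leI)
      also have "\<dots> = 2 * (\<integral>\<^sup>+x. ennreal ((F z x - step x)\<^sup>2) \<partial>lborel) +
          2 * (\<integral>\<^sup>+x. ennreal ((G z x - step x)\<^sup>2) \<partial>lborel)"
        by (simp add: nn_integral_add nn_integral_cmult)
      also have "\<dots> \<le> 2 * ennreal C + 2 * ennreal C"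
        by (intro add_mono mult_left_mono bF bG z) auto
      also have "\<dots> = ennreal (4 * C)"
        using C by (simp add: ennreal_mult'[symmetric] ennreal_plus[symmetric] ennreal_numeral[symmetric]
             del: ennreal_plus ennreal_numeral)
      finally show ?thesis .
    qed
    let ?I = "\<integral>\<^sup>+x. ennreal ((F z x - G z x)\<^sup>2) \<partial>lborel"
    have "(\<integral>\<^sup>+x. ennreal ((F z x - G z x)\<^sup>2) \<partial>lborel) \<le> ennreal (\<gamma> ^ n * (4 * C))"
      if "z \<in> space M" for n z
      using that
    \<comment> \<open>The contraction at one \<open>z\<close> consumes the bound at every possible
      next point, so the hypothesis must hold for all of them.\<close>
    proof (induction n arbitrary: z)
      case (Suc n)
      have "(\<integral>\<^sup>+x. ennreal ((bellman F z x - bellman G z x)\<^sup>2) \<partial>lborel) \<le> ennreal \<gamma> * ennreal (\<gamma> ^ n * (4 * C))"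
        by (rule bellman_contraction[OF F(1) G(1) Suc.prems convex_power2])
           (auto simp: abs_square_le_1 Suc.IH)
      then show ?case
        using \<gamma>_pos C F G by (simp add: ennreal_mult[symmetric] mult.assoc)
    qed (simp add: base)
    moreover have "(\<lambda>n. ennreal (\<gamma> ^ n * (4 * C))) \<longlonglongrightarrow> ennreal 0"
    proof (rule tendsto_ennrealI)
      have "(\<lambda>n. \<gamma> ^ n * (4 * C)) \<longlonglongrightarrow> 0 * (4 * C)"
        using \<gamma>_pos \<gamma>_less_1 by (intro tendsto_intros LIMSEQ_realpow_zero) auto
      then show "(\<lambda>n. \<gamma> ^ n * (4 * C)) \<longlonglongrightarrow> 0" by simp
    qed
    ultimately have "?I \<le> ennreal 0" using z by (intro tendsto_lowerbound) auto
    then have "?I = 0" by simp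
    then show "AE x in lborel. F z x = G z x"
      using dist[OF z, THEN distribution_function_measurable]
      by (subst (asm) nn_integral_0_iff_AE) auto
  qed (use dist[OF z] in \<open>auto simp: distribution_function_def\<close>)
qed (use cdf_familyD(1) F G in auto)

end

section \<open>Existence: an invariant ball around the step family\<close>

locale bounded_affine_bellman = affine_bellman M N c \<gamma>
  for M :: "'b measure" and N :: "'b \<Rightarrow> 'b measure" and c :: "'b \<Rightarrow> 'b \<Rightarrow> real" and \<gamma> :: real +
  fixes B :: real
  assumes B_nonneg: "0 \<le> B"
    and moment: "z \<in> space M \<Longrightarrow> (\<integral>\<^sup>+w. ennreal \<bar>c z w\<bar> \<partial>N z) \<le> ennreal B"
    and measurable_bellman: "\<lbrakk>cdf_family F;
        \<And>z. z \<in> space M \<Longrightarrow> (\<integral>\<^sup>+x. ennreal \<bar>F z x - step x\<bar> \<partial>lborel) \<le> ennreal k\<rbrakk>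
      \<Longrightarrow> (\<lambda>z. bellman F z x) \<in> borel_measurable M"
begin

definition step_family :: "'b \<Rightarrow> real \<Rightarrow> real" where
  "step_family = (\<lambda>z\<in>space M. step)"

text \<open>The solution of \<open>\<gamma> K + B = K\<close>, so that the \<open>L\<^sup>1\<close> ball of radius \<open>K\<close> is invariant.\<close>

definition K :: real where "K = B / (1 - \<gamma>)"

lemma K_nonneg: "0 \<le> K"
  using B_nonneg \<gamma>_less_1 by (simp add: K_def)

lemma K_eq: "\<gamma> * K + B = K"
  using \<gamma>_less_1 by (simp add: K_def field_simps)

definition near_step :: "('b \<Rightarrow> real \<Rightarrow> real) \<Rightarrow> bool" where
  "near_step F \<longleftrightarrow> cdf_family F \<and>
     (\<forall>z\<in>space M. (\<integral>\<^sup>+x. ennreal \<bar>F z x - step x\<bar> \<partial>lborel) \<le> ennreal K)"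

lemma cdf_family_step: "cdf_family step_family"
  using distribution_function_step
  by (auto simp: cdf_family_def step_family_def cong: measurable_cong)

lemma near_step_step: "near_step step_family"
  unfolding near_step_def using cdf_family_step by (simp add: step_family_def)

lemma bellman_L1_contraction:
  assumes "cdf_family F" "cdf_family G" "z \<in> space M"
    and "\<And>w. w \<in> space M \<Longrightarrow> (\<integral>\<^sup>+x. ennreal \<bar>F w x - G w x\<bar> \<partial>lborel) \<le> C"
  shows "(\<integral>\<^sup>+x. ennreal \<bar>bellman F z x - bellman G z x\<bar> \<partial>lborel) \<le> ennreal \<gamma> * C"
proof (rule bellman_contraction[OF assms(1-3), where \<phi> = abs])
  show "convex_on UNIV (abs :: real \<Rightarrow> real)"
    using convex_on_dist[of UNIV "0::real"] by (simp add: dist_real_def)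
qed (use assms(4) in auto)

text \<open>Since \<open>(x - c) / \<gamma> \<ge> 0\<close> exactly when \<open>x \<ge> c\<close>,
  the rescaled step is a step at \<open>c\<close>. It differs from the step at 0 only between 0 and
  \<open>c\<close>, so the \<open>L\<^sup>1\<close> distance for each outcome is at most
  \<open>\<bar>c\<bar>\<close>, and averaging produces the first moment.\<close>

lemma bellman_step_le:
  assumes z: "z \<in> space M"
  shows "(\<integral>\<^sup>+x. ennreal \<bar>bellman step_family z x - step x\<bar> \<partial>lborel) \<le> ennreal B"
proof -
  interpret prob_space "N z" by (rule prob_space_N[OF z])
  interpret pair_sigma_finite "N z" lborel ..
  define D :: "'b \<Rightarrow> real \<Rightarrow> real" where "D w x = step_family w ((x - c z w) / \<gamma>) - step x" for w x
  note [measurable] = measurable_bellman_integrand[OF cdf_family_step z]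
    measurable_bellman_integrand_at[OF cdf_family_step z]
  have [measurable]: "(\<lambda>(w, x). D w x) \<in> borel_measurable (N z \<Otimes>\<^sub>M borel)"
    "(\<lambda>w. D w x) \<in> borel_measurable (N z)" for x
    unfolding D_def by measurable
  have "(\<integral>\<^sup>+x. ennreal \<bar>bellman step_family z x - step x\<bar> \<partial>lborel) \<le>
      (\<integral>\<^sup>+x. \<integral>\<^sup>+w. ennreal \<bar>D w x\<bar> \<partial>N z \<partial>lborel)"
  proof (rule nn_integral_mono)
    fix x
    have int: "integrable (N z) (\<lambda>w. D w x)"
      unfolding D_def using integrable_bellman[OF cdf_family_step z] by simp
    have "bellman step_family z x - step x = expectation (\<lambda>w. D w x)"
      using z integrable_bellman[OF cdf_family_step z] by (simp add: bellman_def D_def prob_space)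
    then show "ennreal \<bar>bellman step_family z x - step x\<bar> \<le> (\<integral>\<^sup>+w. ennreal \<bar>D w x\<bar> \<partial>N z)"
      using integral_norm_bound_ennreal[OF int] by simp
  qed
  also have "\<dots> = (\<integral>\<^sup>+w. \<integral>\<^sup>+x. ennreal \<bar>D w x\<bar> \<partial>lborel \<partial>N z)"
    by (rule Fubini') measurable
  also have "\<dots> \<le> (\<integral>\<^sup>+w. ennreal \<bar>c z w\<bar> \<partial>N z)"
  proof (rule nn_integral_mono)
    fix w assume "w \<in> space (N z)"
    then have w: "w \<in> space M" using space_N[OF z] by simp
    have "\<bar>D w x\<bar> \<le> indicator {min 0 (c z w)..max 0 (c z w)} x" for x
      using w \<gamma>_pos by (auto simp: D_def step_family_def indicator_def zero_le_divide_iff)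
    then have "(\<integral>\<^sup>+x. ennreal \<bar>D w x\<bar> \<partial>lborel)
        \<le> (\<integral>\<^sup>+x. indicator {min 0 (c z w)..max 0 (c z w)} x \<partial>lborel)"
      by (intro nn_integral_mono) (metis ennreal_indicator ennreal_leI)
    also have "\<dots> = ennreal \<bar>c z w\<bar>" by (simp add: max_def min_def)
    finally show "(\<integral>\<^sup>+x. ennreal \<bar>D w x\<bar> \<partial>lborel) \<le> ennreal \<bar>c z w\<bar>" .
  qed
  also have "\<dots> \<le> ennreal B" by (rule moment[OF z])
  finally show ?thesis .
qed

text \<open>Measurability in \<open>z\<close> is available for families at uniformly bounded
  \<open>L\<^sup>1\<close> distance from the step; \<open>near_step\<close> provides this with bound
  \<open>K\<close>.\<close>

lemma cdf_family_bellman: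
  assumes "near_step F"
  shows "cdf_family (bellman F)"
proof -
  have "bellman F \<in> extensional (space M)" by (simp add: bellman_def)
  moreover have "(\<lambda>z. bellman F z x) \<in> borel_measurable M" for x
    using assms by (intro measurable_bellman[of F K]) (auto simp: near_step_def)
  ultimately show ?thesis
    using assms distribution_function_bellman by (auto simp: cdf_family_def near_step_def)
qed

text \<open>Triangle inequality through the image of the step family: the contraction contributes
  \<open>\<gamma> * K\<close>, the displacement of the step itself contributes \<open>B\<close>, and
  these add up to \<open>K\<close>.\<close>

lemma near_step_bellman:
  assumes F: "near_step F"
  shows "near_step (bellman F)"
  unfolding near_step_def
proof (intro conjI ballI cdf_family_bellman[OF F])
  fix z assume z: "z \<in> space M"
  have "(\<integral>\<^sup>+x. ennreal \<bar>bellman F z x - step x\<bar> \<partial>lborel) \<le>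
      (\<integral>\<^sup>+x. ennreal \<bar>bellman F z x - bellman step_family z x\<bar> \<partial>lborel) +
      (\<integral>\<^sup>+x. ennreal \<bar>bellman step_family z x - step x\<bar> \<partial>lborel)"
    by (intro nn_integral_abs_triangle cdf_familyD(3)[OF _ z] cdf_family_bellman F near_step_step
        distribution_function_step)
  also have "\<dots> \<le> ennreal \<gamma> * ennreal K + ennreal B"
    using F near_step_step z
    by (intro add_mono bellman_L1_contraction bellman_step_le) (auto simp: near_step_def step_family_def)
  also have "\<dots> = ennreal K"
    using \<gamma>_pos K_nonneg B_nonneg K_eq
    by (simp add: ennreal_mult[symmetric] ennreal_plus[symmetric] del: ennreal_plus)
  finally show "(\<integral>\<^sup>+x. ennreal \<bar>bellman F z x - step x\<bar> \<partial>lborel) \<le> ennreal K" .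
qed

section \<open>Iterates of the step family and their limit\<close>

definition iter :: "nat \<Rightarrow> 'b \<Rightarrow> real \<Rightarrow> real" where
  "iter n = (bellman ^^ n) step_family"

lemma near_step_iter: "near_step (iter n)"
  by (induction n) (auto simp: iter_def near_step_step near_step_bellman)

lemma cdf_family_iter: "cdf_family (iter n)"
  using near_step_iter by (simp add: near_step_def)

text \<open>Invariance of the ball is the case \<open>n = 0\<close>, and each further application
  gains a factor \<open>\<gamma>\<close>. The bound does not involve \<open>m\<close>, so
  \<open>m\<close> can later tend to infinity with \<open>n\<close> fixed.\<close>

lemma iter_diff_le:
  assumes "z \<in> space M"
  shows "(\<integral>\<^sup>+x. ennreal \<bar>iter (n + m) z x - iter n z x\<bar> \<partial>lborel) \<le> ennreal (\<gamma> ^ n * K)"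
  using assms
proof (induction n arbitrary: z)
  case 0
  then show ?case using near_step_iter[of m] by (simp add: near_step_def iter_def step_family_def)
next
  case (Suc n)
  have "(\<integral>\<^sup>+x. ennreal \<bar>bellman (iter (n + m)) z x - bellman (iter n) z x\<bar> \<partial>lborel)
      \<le> ennreal \<gamma> * ennreal (\<gamma> ^ n * K)"
    by (intro bellman_L1_contraction cdf_family_iter Suc)
  then show ?case
    using \<gamma>_pos K_nonneg by (simp add: iter_def ennreal_mult[symmetric] mult.assoc)
qed

text \<open>The upper limit, unlike the almost everywhere limit, is monotone in \<open>x\<close> and measurable in \<open>z\<close>
  without exceptional sets.\<close>

definition iter_limsup :: "'b \<Rightarrow> real \<Rightarrow> real" where
  "iter_limsup z x = real_of_ereal (limsup (\<lambda>n. ereal (iter n z x)))"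

definition limit :: "'b \<Rightarrow> real \<Rightarrow> real" where
  "limit = (\<lambda>z\<in>space M. right_limit (iter_limsup z))"

lemma limsup_iter_bounds:
  assumes z: "z \<in> space M"
  shows "0 \<le> limsup (\<lambda>n. ereal (iter n z x))" "limsup (\<lambda>n. ereal (iter n z x)) \<le> 1"
proof -
  show "limsup (\<lambda>n. ereal (iter n z x)) \<le> 1"
    using cdf_family_bounds[OF cdf_family_iter z] by (intro Limsup_bounded) auto
  have "0 \<le> liminf (\<lambda>n. ereal (iter n z x))"
    using cdf_family_bounds[OF cdf_family_iter z] by (intro Liminf_bounded) auto
  also have "\<dots> \<le> limsup (\<lambda>n. ereal (iter n z x))" by (intro Liminf_le_Limsup) simp
  finally show "0 \<le> limsup (\<lambda>n. ereal (iter n z x))" .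
qed

text \<open>All iterates lie in \<open>[0, 1]\<close>, so the upper limit is finite and
  \<open>real_of_ereal\<close> never falls back on its default value at infinity.\<close>

lemma ereal_iter_limsup:
  assumes z: "z \<in> space M"
  shows "ereal (iter_limsup z x) = limsup (\<lambda>n. ereal (iter n z x))"
  unfolding iter_limsup_def using limsup_iter_bounds[OF z, of x]
  by (cases "limsup (\<lambda>n. ereal (iter n z x))") auto

lemma iter_limsup_bounds:
  assumes z: "z \<in> space M"
  shows "0 \<le> iter_limsup z x" "iter_limsup z x \<le> 1"
  using limsup_iter_bounds[OF z, of x] unfolding ereal_iter_limsup[OF z, symmetric] by auto

lemma mono_iter_limsup:
  assumes z: "z \<in> space M"
  shows "mono (iter_limsup z)"
proof (rule monoI)
  fix x y :: real assume "x \<le> y"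
  then have "limsup (\<lambda>n. ereal (iter n z x)) \<le> limsup (\<lambda>n. ereal (iter n z y))"
    using cdf_familyD(3)[OF cdf_family_iter z]
    by (intro Limsup_mono always_eventually) (auto simp: distribution_function_def mono_def)
  then show "iter_limsup z x \<le> iter_limsup z y"
    using ereal_iter_limsup[OF z] by (metis ereal_less_eq(3))
qed

text \<open>Two null sets are discarded: the points where the iterates diverge, and those where
  passing to the right limit alters the upper limit.\<close>

lemma AE_iter_tendsto_limit:
  assumes z: "z \<in> space M"
  shows "AE x in lborel. (\<lambda>n. iter n z x) \<longlonglongrightarrow> limit z x"
proof -
  have "AE x in lborel. convergent (\<lambda>n. iter n z x)"
  proof (rule AE_convergent_if_nn_integral_diff_le)
    show "(\<integral>\<^sup>+x. ennreal \<bar>iter (Suc n) z x - iter n z x\<bar> \<partial>lborel) \<le> ennreal (\<gamma> ^ n * K)" for n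
      using iter_diff_le[OF z, of n 1] by simp
  qed (use \<gamma>_pos \<gamma>_less_1 K_nonneg distribution_function_measurable[OF cdf_familyD(3)[OF cdf_family_iter z]]
       in \<open>auto intro!: summable_mult2 summable_geometric\<close>)
  then show ?thesis
    using AE_right_limit_eq[OF mono_iter_limsup[OF z]]
  proof eventually_elim
    case (elim x)
    then obtain l where l: "(\<lambda>n. iter n z x) \<longlonglongrightarrow> l" by (auto simp: convergent_def)
    then have "limsup (\<lambda>n. ereal (iter n z x)) = ereal l"
      by (intro lim_imp_Limsup) auto
    with l elim z show ?case by (simp add: limit_def iter_limsup_def)
  qed
qed

lemma limit_bounds:
  assumes z: "z \<in> space M"
  shows "0 \<le> limit z x" "limit z x \<le> 1"
proof -
  show "0 \<le> limit z x"
    using le_right_limit[OF mono_iter_limsup[OF z], of x] iter_limsup_bounds(1)[OF z, of x] z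
    by (simp add: limit_def)
  show "limit z x \<le> 1"
    using right_limit_le[OF mono_iter_limsup[OF z], of x "x + 1"] iter_limsup_bounds(2)[OF z, of "x + 1"] z
    by (simp add: limit_def)
qed

text \<open>Fatou's lemma applied to \<open>iter_diff_le\<close> as \<open>m\<close> tends to
  infinity.\<close>

lemma limit_diff_le:
  assumes z: "z \<in> space M"
  shows "(\<integral>\<^sup>+x. ennreal \<bar>limit z x - iter n z x\<bar> \<partial>lborel) \<le> ennreal (\<gamma> ^ n * K)"
proof -
  have [measurable]: "iter n z \<in> borel_measurable borel" for n
    using distribution_function_measurable[OF cdf_familyD(3)[OF cdf_family_iter z]] .
  have "(\<integral>\<^sup>+x. ennreal \<bar>limit z x - iter n z x\<bar> \<partial>lborel)
      = (\<integral>\<^sup>+x. liminf (\<lambda>m. ennreal \<bar>iter (n + m) z x - iter n z x\<bar>) \<partial>lborel)"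
  proof (rule nn_integral_cong_AE, use AE_iter_tendsto_limit[OF z] in eventually_elim)
    case (elim x)
    then have "(\<lambda>m. iter (m + n) z x) \<longlonglongrightarrow> limit z x" by (rule LIMSEQ_ignore_initial_segment)
    then have "(\<lambda>m. ennreal \<bar>iter (n + m) z x - iter n z x\<bar>) \<longlonglongrightarrow> ennreal \<bar>limit z x - iter n z x\<bar>"
      by (intro tendsto_intros) (simp add: add.commute)
    then show ?case by (intro lim_imp_Liminf[symmetric]) auto
  qed
  also have "\<dots> \<le> liminf (\<lambda>m. \<integral>\<^sup>+x. ennreal \<bar>iter (n + m) z x - iter n z x\<bar> \<partial>lborel)"
    by (rule nn_integral_liminf) measurable
  also have "\<dots> \<le> liminf (\<lambda>m. ennreal (\<gamma> ^ n * K))"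
    by (intro Liminf_mono always_eventually allI iter_diff_le z)
  finally show ?thesis by (simp add: Liminf_const)
qed

lemma near_step_limit: "near_step limit"
proof -
  have le: "(\<integral>\<^sup>+x. ennreal \<bar>limit z x - step x\<bar> \<partial>lborel) \<le> ennreal K" if z: "z \<in> space M" for z
    \<comment> \<open>The iterate with index 0 is the step itself, so the limit stays in the ball of
      radius \<open>K\<close>; this finite distance also yields its tails.\<close>
    using limit_diff_le[OF z, of 0] z by (simp add: iter_def step_family_def)
  have "distribution_function (limit z)" if z: "z \<in> space M" for z
  proof (rule distribution_functionI_integrable_diff)
    show "mono (limit z)"
      using z mono_right_limit[OF mono_iter_limsup[OF z]] by (simp add: limit_def)
    show "continuous (at_right x) (limit z)" for x
      using z continuous_right_limit[OF mono_iter_limsup[OF z]] by (simp add: limit_def)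
    show "(\<integral>\<^sup>+x. ennreal \<bar>limit z x - step x\<bar> \<partial>lborel) < \<infinity>"
      using le[OF z] by (simp add: order_le_less_trans)
  qed (use limit_bounds[OF z] in auto)
  moreover have "(\<lambda>z. limit z x) \<in> borel_measurable M" for x
  proof -
    have [measurable]: "(\<lambda>z. iter n z x) \<in> borel_measurable M" for n x
      using cdf_familyD(2)[OF cdf_family_iter] .
    have "(\<lambda>z. right_limit (iter_limsup z) x) \<in> borel_measurable M"
    proof (rule measurable_right_limit)
      show "(\<lambda>z. iter_limsup z x) \<in> borel_measurable M" for x
        unfolding iter_limsup_def by measurable
    qed (rule mono_iter_limsup)
    then show ?thesis by (simp add: limit_def cong: measurable_cong)
  qed
  moreover have "limit \<in> extensional (space M)" by (simp add: limit_def)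
  ultimately show ?thesis using le by (auto simp: near_step_def cdf_family_def)
qed

text \<open>Both \<open>limit\<close> and its image lie within \<open>\<gamma> ^ Suc n * K\<close>
  of \<open>iter (Suc n)\<close>: the first by the convergence rate, the second by contracting the
  distance of \<open>limit\<close> to \<open>iter n\<close>. Letting \<open>n\<close> grow makes
  them equal almost everywhere, hence everywhere.\<close>

lemma bellman_limit: "bellman limit = limit"
proof (rule extensionalityI[of _ "space M"])
  note lim = near_step_limit[unfolded near_step_def, THEN conjunct1]
  note dist = cdf_familyD(3)[OF lim] cdf_familyD(3)[OF cdf_family_bellman[OF near_step_limit]]
    cdf_familyD(3)[OF cdf_family_iter]
  show "bellman limit z = limit z" if z: "z \<in> space M" for z
  proof (rule right_cont_eq_if_AE_eq)
    let ?I = "\<integral>\<^sup>+x. ennreal \<bar>bellman limit z x - limit z x\<bar> \<partial>lborel"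
    have "?I \<le> ennreal (2 * \<gamma> ^ Suc n * K)" for n
    proof -
      have "?I \<le> (\<integral>\<^sup>+x. ennreal \<bar>bellman limit z x - iter (Suc n) z x\<bar> \<partial>lborel) +
          (\<integral>\<^sup>+x. ennreal \<bar>iter (Suc n) z x - limit z x\<bar> \<partial>lborel)"
        by (intro nn_integral_abs_triangle dist z)
      also have "\<dots> \<le> ennreal \<gamma> * ennreal (\<gamma> ^ n * K) + ennreal (\<gamma> ^ Suc n * K)"
      proof (rule add_mono)
        show "(\<integral>\<^sup>+x. ennreal \<bar>bellman limit z x - iter (Suc n) z x\<bar> \<partial>lborel) \<le> ennreal \<gamma> * ennreal (\<gamma> ^ n * K)"
          using bellman_L1_contraction[OF lim cdf_family_iter[of n] z limit_diff_le] by (simp add: iter_def)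
        show "(\<integral>\<^sup>+x. ennreal \<bar>iter (Suc n) z x - limit z x\<bar> \<partial>lborel) \<le> ennreal (\<gamma> ^ Suc n * K)"
          using limit_diff_le[OF z, of "Suc n"] by (simp add: abs_minus_commute)
      qed
      also have "\<dots> = ennreal (2 * \<gamma> ^ Suc n * K)"
        using \<gamma>_pos K_nonneg
        by (simp add: ennreal_mult[symmetric] ennreal_plus[symmetric] algebra_simps del: ennreal_plus)
      finally show ?thesis .
    qed
    moreover have "(\<lambda>n. ennreal (2 * \<gamma> ^ Suc n * K)) \<longlonglongrightarrow> ennreal 0"
    proof (rule tendsto_ennrealI)
      have "(\<lambda>n. \<gamma> ^ Suc n) \<longlonglongrightarrow> 0"
        using \<gamma>_pos \<gamma>_less_1 by (intro LIMSEQ_Suc LIMSEQ_realpow_zero) auto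
      then have "(\<lambda>n. 2 * \<gamma> ^ Suc n * K) \<longlonglongrightarrow> 2 * 0 * K" by (intro tendsto_intros)
      then show "(\<lambda>n. 2 * \<gamma> ^ Suc n * K) \<longlonglongrightarrow> 0" by simp
    qed
    ultimately have "?I \<le> ennreal 0" by (intro tendsto_lowerbound) auto
    then have "?I = 0" by simp
    then show "AE x in lborel. bellman limit z x = limit z x"
      using dist(1,2)[OF z, THEN distribution_function_measurable]
      by (subst (asm) nn_integral_0_iff_AE) auto
  qed (use dist(1,2)[OF z] in \<open>auto simp: distribution_function_def\<close>)
qed (auto simp: bellman_def limit_def)

end

section \<open>Application to the decision process\<close>

lemma measurable_next_state_action:
  assumes [measurable]: "P \<in> S \<Otimes>\<^sub>M A \<rightarrow>\<^sub>M prob_algebra S" "\<pi> \<in> S \<rightarrow>\<^sub>M prob_algebra A"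
  shows "next_state_action S A P \<pi> \<in> S \<Otimes>\<^sub>M A \<rightarrow>\<^sub>M prob_algebra (S \<Otimes>\<^sub>M A)"
proof -
  have "(\<lambda>sa. P sa \<bind> (\<lambda>s'. \<pi> s' \<bind> (\<lambda>a'. return (S \<Otimes>\<^sub>M A) (s', a'))))
      \<in> S \<Otimes>\<^sub>M A \<rightarrow>\<^sub>M prob_algebra (S \<Otimes>\<^sub>M A)"
    by measurable
  then show ?thesis by (simp add: next_state_action_def[abs_def])
qed

theorem proposition10:
  fixes S :: "'s measure" and A :: "'a measure"
    and P :: "'s \<times> 'a \<Rightarrow> 's measure" and R :: "'s \<Rightarrow> 'a \<Rightarrow> 's \<Rightarrow> real"
    and \<gamma> \<alpha> :: real
    and \<pi> :: "'s \<Rightarrow> 'a measure" and \<nu> :: "'a measure" and p :: "'s \<Rightarrow> 'a \<Rightarrow> real"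
  assumes mdp: "discounted_mdp S A P R \<gamma>"
    and alpha: "0 < \<alpha>"
    and policy: "stationary_policy S A \<pi>"
    and dens: "policy_density S A \<pi> \<nu> p"
    and log_defined: "\<forall>s\<in>space S. AE a in \<pi> s. 0 < p s a"
    and bounded: "(SUP (s, a)\<in>space (S \<Otimes>\<^sub>M A).
        \<integral>\<^sup>+(s', a'). ennreal \<bar>R s a s' - \<gamma> * \<alpha> * ln (p s' a')\<bar>
          \<partial>next_state_action S A P \<pi> (s, a)) < \<infinity>"
    and meas: "\<forall>F\<in>cdf_fields S A. \<forall>x.
        (\<lambda>(s, a). \<integral>(s', a'). F (s', a') ((x - R s a s') / \<gamma> + \<alpha> * ln (p s' a'))
          \<partial>next_state_action S A P \<pi> (s, a)) \<in> borel_measurable (S \<Otimes>\<^sub>M A)"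
  shows "\<exists>!F. F \<in> cdf_fields S A \<and> bellman_cdf S A P R \<gamma> \<alpha> \<pi> p F = F"
proof -
  let ?M = "S \<Otimes>\<^sub>M A" and ?N = "next_state_action S A P \<pi>"
  define c where "c = (\<lambda>(s, a) (s', a'). R s a s' - \<gamma> * \<alpha> * ln (p s' a'))"
  have \<gamma>: "0 < \<gamma>" "\<gamma> < 1" using mdp by (auto simp: discounted_mdp_def)
  have N: "prob_space (?N z)" "sets (?N z) = sets ?M" if "z \<in> space ?M" for z
    using measurable_space[OF measurable_next_state_action that, of P \<pi>] mdp policy
    by (auto simp: discounted_mdp_def stationary_policy_def space_prob_algebra)
  have measurable_c: "c z \<in> borel_measurable ?M" if z: "z \<in> space ?M" for z
  proof -
    obtain s a where sa: "z = (s, a)" "s \<in> space S" "a \<in> space A"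
      using z by (auto simp: space_pair_measure)
    have [measurable]: "(\<lambda>(s, a, s'). R s a s') \<in> borel_measurable (S \<Otimes>\<^sub>M A \<Otimes>\<^sub>M S)"
      "(\<lambda>(s, a). p s a) \<in> borel_measurable ?M"
      using mdp dens by (auto simp: discounted_mdp_def policy_density_def)
    \<comment> \<open>The current pair is frozen, so the jointly measurable reward becomes a
      measurable function of the next state.\<close>
    have "(\<lambda>w. (\<lambda>(s, a, s'). R s a s') (s, a, fst w)) \<in> borel_measurable ?M"
      using sa by measurable
    then have [measurable]: "(\<lambda>w. R s a (fst w)) \<in> borel_measurable ?M" by simp
    have "(\<lambda>w. R s a (fst w) - \<gamma> * \<alpha> * ln ((\<lambda>(s, a). p s a) w)) \<in> borel_measurable ?M"
      by measurable
    then show ?thesis by (simp add: c_def sa case_prod_beta)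
  qed
  interpret affine_bellman ?M ?N c \<gamma>
    by (rule affine_bellman.intro) (fact N measurable_c \<gamma>)+
  have bellman_eq: "bellman F = bellman_cdf S A P R \<gamma> \<alpha> \<pi> p F" for F
  proof -
    have "(x - c z w) / \<gamma> = (x - R (fst z) (snd z) (fst w)) / \<gamma> + \<alpha> * ln (p (fst w) (snd w))" for x z w
      using \<gamma> by (simp add: c_def split_beta field_simps)
    then show ?thesis
      unfolding bellman_def bellman_cdf_def by (intro restrict_ext) (simp add: case_prod_unfold)
  qed
  \<comment> \<open>A finite supremum bounds each single integral, so the integrability condition
    inside \<open>Gamma_cdf\<close> is implied by the uniform one.\<close>
  have cdf_fields_iff: "F \<in> cdf_fields S A \<longleftrightarrow> cdf_family F \<and>
      (SUP z\<in>space ?M. \<integral>\<^sup>+x. ennreal ((F z x - step x)\<^sup>2) \<partial>lborel) < \<infinity>" for F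
  proof
    assume "cdf_family F \<and> (SUP z\<in>space ?M. \<integral>\<^sup>+x. ennreal ((F z x - step x)\<^sup>2) \<partial>lborel) < \<infinity>"
    moreover from this have "(\<integral>\<^sup>+x. ennreal ((F z x - step x)\<^sup>2) \<partial>lborel) < \<infinity>" if "z \<in> space ?M" for z
      using order_le_less_trans[OF SUP_upper[OF that]] by blast
    ultimately show "F \<in> cdf_fields S A"
      by (auto simp: cdf_fields_def cdf_family_def PiE_def mem_Gamma_cdf_iff)
  qed (auto simp: cdf_fields_def cdf_family_def PiE_def Pi_def mem_Gamma_cdf_iff)
  \<comment> \<open>Used twice: it brings the iterates and their limit under the measurability
    hypothesis, and it places the limit in \<open>cdf_fields\<close>.\<close>
  have near: "F \<in> cdf_fields S A"
    if F: "cdf_family F"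
      and le: "\<And>z. z \<in> space ?M \<Longrightarrow> (\<integral>\<^sup>+x. ennreal \<bar>F z x - step x\<bar> \<partial>lborel) \<le> ennreal k" for F k
  proof -
    have "(SUP z\<in>space ?M. \<integral>\<^sup>+x. ennreal ((F z x - step x)\<^sup>2) \<partial>lborel) \<le> ennreal k"
      by (intro SUP_least order_trans[OF cdf_family_square_le_abs[OF F] le])
    then show ?thesis
      using F by (simp add: cdf_fields_iff order_le_less_trans)
  qed
  \<comment> \<open>The supremum in hypothesis (b). It is finite, so \<open>enn2real\<close>
    preserves its value and can serve as the moment bound.\<close>
  define B where "B = (SUP z\<in>space ?M. \<integral>\<^sup>+w. ennreal \<bar>c z w\<bar> \<partial>?N z)"
  have "B < \<infinity>"
    using bounded by (simp add: B_def c_def case_prod_unfold)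
  then have B: "ennreal (enn2real B) = B" by simp
  interpret bounded_affine_bellman ?M ?N c \<gamma> "enn2real B"
  proof unfold_locales
    show "(\<integral>\<^sup>+w. ennreal \<bar>c z w\<bar> \<partial>?N z) \<le> ennreal (enn2real B)" if "z \<in> space ?M" for z
      unfolding B unfolding B_def by (rule SUP_upper[OF that])
    show "(\<lambda>z. bellman F z x) \<in> borel_measurable ?M"
      if "cdf_family F" "\<And>z. z \<in> space ?M \<Longrightarrow> (\<integral>\<^sup>+x. ennreal \<bar>F z x - step x\<bar> \<partial>lborel) \<le> ennreal k" for F k x
    proof -
      have "(\<lambda>(s, a). \<integral>(s', a'). F (s', a') ((x - R s a s') / \<gamma> + \<alpha> * ln (p s' a')) \<partial>?N (s, a))
          \<in> borel_measurable ?M"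
        using near[OF that] meas by blast
      then show ?thesis
        unfolding bellman_eq bellman_cdf_def by (rule measurable_cong[THEN iffD1, rotated]) auto
    qed
  qed simp
  show ?thesis
  proof (rule ex1I[of _ limit])
    have "limit \<in> cdf_fields S A"
      using near_step_limit near by (auto simp: near_step_def)
    then show "limit \<in> cdf_fields S A \<and> bellman_cdf S A P R \<gamma> \<alpha> \<pi> p limit = limit"
      using bellman_limit by (simp add: bellman_eq)
    fix F assume F: "F \<in> cdf_fields S A \<and> bellman_cdf S A P R \<gamma> \<alpha> \<pi> p F = F"
    \<comment> \<open>A competing fixed point is known only to have bounded squared distance to the
      step, which is why uniqueness works with squares. The maximum of the two suprema is one bound
      valid for both fields.\<close>
    define C where "C G = (SUP z\<in>space ?M. \<integral>\<^sup>+x. ennreal ((G z x - step x)\<^sup>2) \<partial>lborel)"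
      for G :: "'s \<times> 'a \<Rightarrow> real \<Rightarrow> real"
    have C: "(\<integral>\<^sup>+x. ennreal ((G z x - step x)\<^sup>2) \<partial>lborel) \<le> ennreal (enn2real (max (C F) (C limit)))"
      if "z \<in> space ?M" "G \<in> {F, limit}" for z G
    proof -
      have "(\<integral>\<^sup>+x. ennreal ((G z x - step x)\<^sup>2) \<partial>lborel) \<le> C G"
        unfolding C_def by (rule SUP_upper[OF that(1)])
      also have "\<dots> \<le> max (C F) (C limit)" using that(2) by auto
      also have "\<dots> = ennreal (enn2real (max (C F) (C limit)))"
        using F \<open>limit \<in> cdf_fields S A\<close> by (simp add: C_def cdf_fields_iff)
      finally show ?thesis .
    qed
    show "F = limit"
    proof (rule bellman_fixed_point_unique[where C = "enn2real (max (C F) (C limit))"])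
      show "cdf_family F" "bellman F = F" using F by (simp_all add: bellman_eq cdf_fields_iff)
      show "cdf_family limit" using near_step_limit by (simp add: near_step_def)
      show "bellman limit = limit" by (rule bellman_limit)
    qed (use C in simp_all)
  qed
qed

end
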